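(* There is a numerical (absolute) constant $C_1>0$ such that the following holds. Let $A,B\subset\mathbb Z^2$ be nonempty finite sets, $N=|A+B|$, and suppose that $A=\dot\bigcup_{u=1}^{R_A}A_u$ and $B=\dot\bigcup_{v=1}^{R_B}B_v$ are disjoint unions, where $A_u=I_{u,1}\times I_{u,2}$ and $B_v=J_{v,1}\times J_{v,2}$ are Cartesian rectangles of integer intervals. Define $$c_{u,v}=\max_{i=1,2}\max\Big\{\frac{|I_{u,i}+J_{v,i}|}{|I_{u,i}|},\frac{|I_{u,i}+J_{v,i}|}{|J_{v,i}|}\Big\}.$$ Then $$\Gamma_{A,B}\le C_1\log^2(eN)\sum_{u=1}^{R_A}\sum_{v=1}^{R_B}c_{u,v}^2.$$
   Context: Let $S=A+B$. For $k\in S$ let $w(k)=\#\{(\alpha,\beta)\in A\times B:\alpha+\beta=k\}$ and let $G_k\in\mathbb C^{|A|\times|B|}$ be the matrix with entries $w(k)^{-1/2}$ at positions $(\alpha,\beta)$ with $\alpha+\beta=k$ and $0$ elsewhere. With $\langle X,Y\rangle_F=\operatorname{tr}(X^*Y)$, define for $M\in\mathbb C^{|A|\times|B|}$ $$\|M\|_{\mathcal G,2}^2=\sum_{k\in S}\frac{|\langle G_k,M\rangle_F|^2}{w(k)},$$ and let $\|M\|_{\infty,2}^2$ be the maximum of the squared Euclidean norms of all rows and all columns of $M$. The fiber parameter is $\Gamma_{A,B}=\sup_{M\ne0}\|M\|_{\mathcal G,2}^2/\|M\|_{\infty,2}^2$. *)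

theory Defs
  imports "HOL-Analysis.Analysis" "HOL-Library.Set_Algebras"
begin

text \<open>
  Throughout, \<open>A + B\<close> for sets is the sumset of \<open>HOL-Library.Set_Algebras\<close>, and on
  \<open>int \<times> int\<close> addition is componentwise.

  Matrices whose rows are indexed by \<open>A\<close> and whose columns are indexed by \<open>B\<close> are represented by
  functions that vanish outside \<open>A \<times> B\<close>.
\<close>

definition matrices :: "'a set \<Rightarrow> 'b set \<Rightarrow> ('a \<Rightarrow> 'b \<Rightarrow> complex) set" where
  "matrices A B = {M. \<forall>\<alpha> \<beta>. (\<alpha>, \<beta>) \<notin> A \<times> B \<longrightarrow> M \<alpha> \<beta> = 0}"

text \<open>The trace of \<open>X\<^sup>* Y\<close>: the inner sum is the diagonal entry of \<open>X\<^sup>* Y\<close> at \<open>(\<beta>, \<beta>)\<close>.\<close>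

definition frob_inner ::
    "'a set \<Rightarrow> 'b set \<Rightarrow> ('a \<Rightarrow> 'b \<Rightarrow> complex) \<Rightarrow> ('a \<Rightarrow> 'b \<Rightarrow> complex) \<Rightarrow> complex" where
  "frob_inner A B X Y = (\<Sum>\<beta>\<in>B. \<Sum>\<alpha>\<in>A. cnj (X \<alpha> \<beta>) * Y \<alpha> \<beta>)"

definition rep_count :: "'a::plus set \<Rightarrow> 'a set \<Rightarrow> 'a \<Rightarrow> nat" where
  "rep_count A B k = card {(\<alpha>, \<beta>). (\<alpha>, \<beta>) \<in> A \<times> B \<and> \<alpha> + \<beta> = k}"

definition fiber_matrix :: "'a::plus set \<Rightarrow> 'a set \<Rightarrow> 'a \<Rightarrow> 'a \<Rightarrow> 'a \<Rightarrow> complex" where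
  "fiber_matrix A B k \<alpha> \<beta> =
     (if \<alpha> \<in> A \<and> \<beta> \<in> B \<and> \<alpha> + \<beta> = k
      then complex_of_real (real (rep_count A B k) powr (-1/2)) else 0)"

definition fiber_norm_sq :: "'a::plus set \<Rightarrow> 'a set \<Rightarrow> ('a \<Rightarrow> 'a \<Rightarrow> complex) \<Rightarrow> real" where
  "fiber_norm_sq A B M =
     (\<Sum>k\<in>A + B. (cmod (frob_inner A B (fiber_matrix A B k) M))\<^sup>2 / real (rep_count A B k))"

definition row_col_norm_sq :: "'a set \<Rightarrow> 'b set \<Rightarrow> ('a \<Rightarrow> 'b \<Rightarrow> complex) \<Rightarrow> real" where
  "row_col_norm_sq A B M =
     Max ((\<lambda>\<alpha>. \<Sum>\<beta>\<in>B. (cmod (M \<alpha> \<beta>))\<^sup>2) ` A \<union> (\<lambda>\<beta>. \<Sum>\<alpha>\<in>A. (cmod (M \<alpha> \<beta>))\<^sup>2) ` B)"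

text \<open>
  For nonempty finite \<open>A\<close> and \<open>B\<close> the supremum is over a nonempty set that is bounded above
  (see the two lemmas \<open>fiber_parameter_nonempty\<close> and \<open>fiber_parameter_bdd\<close>), so the real-valued
  supremum is the true one.
\<close>

definition fiber_parameter :: "'a::plus set \<Rightarrow> 'a set \<Rightarrow> real" where
  "fiber_parameter A B =
     (SUP M \<in> {M \<in> matrices A B. M \<noteq> (\<lambda>_ _. 0)}. fiber_norm_sq A B M / row_col_norm_sq A B M)"

text \<open>
  Intervals are nonempty, since their cardinalities occur as denominators in
  \<open>rectangle_ratio\<close>.
\<close>

definition int_interval :: "int set \<Rightarrow> bool" where
  "int_interval X \<longleftrightarrow> (\<exists>a b. a \<le> b \<and> X = {a..b})"

text \<open>The constant \<open>c\<close> of the rectangles \<open>I 1 \<times> I 2\<close> and \<open>J 1 \<times> J 2\<close>.\<close>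

definition rectangle_ratio :: "(nat \<Rightarrow> int set) \<Rightarrow> (nat \<Rightarrow> int set) \<Rightarrow> real" where
  "rectangle_ratio I J =
     (MAX i\<in>{1, 2}. max (real (card (I i + J i)) / real (card (I i)))
                        (real (card (I i + J i)) / real (card (J i))))"

lemma fiber_parameter_nonempty:
  assumes "A \<noteq> {}" "B \<noteq> {}"
  shows "{M \<in> matrices A B. M \<noteq> (\<lambda>_ _. 0)} \<noteq> {}"
proof -
  obtain a b where ab: "a \<in> A" "b \<in> B" using assms by blast
  let ?M = "\<lambda>\<alpha> \<beta>. if \<alpha> = a \<and> \<beta> = b then 1 else 0 :: complex"
  have "?M \<in> matrices A B" using ab by (auto simp: matrices_def)
  moreover have "?M \<noteq> (\<lambda>_ _. 0)" by (metis zero_neq_one)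
  ultimately show ?thesis by blast
qed

lemma entry_le_row_col_norm_sq:
  assumes "finite A" "finite B" "\<alpha> \<in> A" "\<beta> \<in> B"
  shows "(cmod (M \<alpha> \<beta>))\<^sup>2 \<le> row_col_norm_sq A B M"
proof -
  have "(cmod (M \<alpha> \<beta>))\<^sup>2 \<le> (\<Sum>\<beta>\<in>B. (cmod (M \<alpha> \<beta>))\<^sup>2)"
    using assms by (intro member_le_sum) auto
  also have "\<dots> \<le> row_col_norm_sq A B M"
    unfolding row_col_norm_sq_def using assms by (intro Max_ge) auto
  finally show ?thesis .
qed

lemma row_col_norm_sq_pos:
  assumes "finite A" "finite B" "M \<in> matrices A B" "M \<noteq> (\<lambda>_ _. 0)"
  shows "row_col_norm_sq A B M > 0"
proof -
  obtain \<alpha> \<beta> where "M \<alpha> \<beta> \<noteq> 0" using assms(4) by (meson ext)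
  then have ne: "M \<alpha> \<beta> \<noteq> 0" and "\<alpha> \<in> A" "\<beta> \<in> B"
    using assms(3) by (auto simp: matrices_def)
  then have "(cmod (M \<alpha> \<beta>))\<^sup>2 \<le> row_col_norm_sq A B M"
    by (intro entry_le_row_col_norm_sq assms)
  moreover have "0 < (cmod (M \<alpha> \<beta>))\<^sup>2" using ne by simp
  ultimately show ?thesis by linarith
qed

lemma cmod_fiber_matrix_le: "cmod (fiber_matrix A B k \<alpha> \<beta>) \<le> 1"
proof (cases "rep_count A B k = 0")
  case False
  then have "real (rep_count A B k) powr (-1/2) \<le> 1 powr (-1/2)"
    by (intro powr_mono2') auto
  then show ?thesis by (simp add: fiber_matrix_def)
qed (simp add: fiber_matrix_def)

lemma fiber_parameter_bdd:
  assumes "finite A" "finite B"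
  shows "bdd_above ((\<lambda>M. fiber_norm_sq A B M / row_col_norm_sq A B M) `
           {M \<in> matrices A B. M \<noteq> (\<lambda>_ _. 0)})"
proof (rule bdd_aboveI2)
  fix M assume "M \<in> {M \<in> matrices A B. M \<noteq> (\<lambda>_ _. 0)}"
  then have pos: "row_col_norm_sq A B M > 0"
    using row_col_norm_sq_pos[OF assms] by blast
  let ?D = "row_col_norm_sq A B M" and ?n = "real (card B) * real (card A)"
  have entry: "cmod (M \<alpha> \<beta>) \<le> sqrt ?D" if "\<alpha> \<in> A" "\<beta> \<in> B" for \<alpha> \<beta>
    using entry_le_row_col_norm_sq[OF assms that, of M] by (simp add: real_le_rsqrt)
  have inner: "cmod (frob_inner A B (fiber_matrix A B k) M) \<le> ?n * sqrt ?D" for k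
  proof -
    have "cmod (\<Sum>\<alpha>\<in>A. cnj (fiber_matrix A B k \<alpha> \<beta>) * M \<alpha> \<beta>) \<le> of_nat (card A) * sqrt ?D"
      if "\<beta> \<in> B" for \<beta>
    proof (rule order_trans[OF norm_sum sum_bounded_above])
      fix \<alpha> assume "\<alpha> \<in> A"
      then show "cmod (cnj (fiber_matrix A B k \<alpha> \<beta>) * M \<alpha> \<beta>) \<le> sqrt ?D"
        using mult_mono[OF cmod_fiber_matrix_le[of A B k \<alpha> \<beta>] entry[OF _ that, of \<alpha>]]
        by (simp add: norm_mult)
    qed
    then have "cmod (frob_inner A B (fiber_matrix A B k) M) \<le>
        of_nat (card B) * (of_nat (card A) * sqrt ?D)"
      unfolding frob_inner_def by (rule order_trans[OF norm_sum sum_bounded_above])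
    then show ?thesis by (simp add: mult.assoc)
  qed
  have "(cmod (frob_inner A B (fiber_matrix A B k) M))\<^sup>2 / real (rep_count A B k) \<le> ?n\<^sup>2 * ?D" for k
  proof -
    have "(cmod (frob_inner A B (fiber_matrix A B k) M))\<^sup>2 \<le> (?n * sqrt ?D)\<^sup>2"
      by (rule power_mono[OF inner]) simp
    also have "\<dots> = ?n\<^sup>2 * ?D" using pos by (simp add: power_mult_distrib)
    finally have *: "(cmod (frob_inner A B (fiber_matrix A B k) M))\<^sup>2 \<le> ?n\<^sup>2 * ?D" .
    show ?thesis
    proof (cases "rep_count A B k = 0")
      case False
      then have "(cmod (frob_inner A B (fiber_matrix A B k) M))\<^sup>2 / real (rep_count A B k)
          \<le> (cmod (frob_inner A B (fiber_matrix A B k) M))\<^sup>2 / 1"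
        by (intro divide_left_mono) auto
      with * show ?thesis by simp
    qed (use pos in simp)
  qed
  then have "fiber_norm_sq A B M \<le> of_nat (card (A + B)) * (?n\<^sup>2 * ?D)"
    unfolding fiber_norm_sq_def by (intro sum_bounded_above)
  then show "fiber_norm_sq A B M / ?D \<le> real (card (A + B)) * ?n\<^sup>2"
    using pos by (simp add: divide_le_eq mult.assoc)
qed

end

theory Submission
  imports Defs
begin

text \<open>
  The estimate rests on trading the factor \<open>1 / w(\<alpha> + \<beta>)\<close> for a function of \<open>\<alpha>\<close> alone.

  Each \<open>G\<^sub>k\<close> has unit Frobenius norm and is supported on the fiber \<open>\<alpha> + \<beta> = k\<close>, so
  Cauchy-Schwarz bounds \<open>\<parallel>M\<parallel>\<^sup>2\<close> in the fiber norm by the sum of \<open>|M \<alpha> \<beta>|\<^sup>2 / w(\<alpha> + \<beta>)\<close> over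
  \<open>A \<times> B\<close> (lemma \<open>fiber_norm_sq_le\<close>). All terms of this sum are nonnegative and \<open>w\<close> only decreases
  when \<open>A\<close> and \<open>B\<close> shrink. The sum may therefore be cut into the blocks \<open>A\<^sub>u \<times> B\<^sub>v\<close>, and in each
  block \<open>w\<close> may be replaced by the representation count of the two rectangles, which is the product
  of the counts in the two coordinates.

  For intervals \<open>I\<close> and \<open>J\<close> the count of \<open>x + y\<close> is small only if \<open>x + y\<close> is near an end of
  \<open>I + J\<close>, and then \<open>x\<close> is equally near the corresponding end of \<open>I\<close>. Quantitatively,
  \<open>1 / w(x + y)\<close> is at most the sum of the reciprocals of \<open>|I|\<close>, of \<open>|J|\<close> and of the distances
  from \<open>x\<close> to the two points just outside \<open>I\<close>; this sum is \<open>end_weight I J x\<close>. It no longer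
  involves \<open>y\<close>, so the inner sum over \<open>\<beta>\<close> is a partial row sum of \<open>|M|\<^sup>2\<close>, bounded by the row and
  column norm. What remains is the product over the two coordinates of the sum of the end weights
  over \<open>I\<close>. Each factor is two harmonic sums plus \<open>1 + |I| / |J|\<close>, hence at most
  \<open>4 log(eN) c\<close> (lemma \<open>sum_end_weight_le_rectangle_ratio\<close>), and squaring gives the constant
  \<open>16\<close>.
\<close>

section \<open>Representation counts and the fiber norm\<close>

lemma rep_count_alt: "rep_count A B k = card {p \<in> A \<times> B. fst p + snd p = k}"
  unfolding rep_count_def by (rule arg_cong[where f = card]) auto

lemma rep_count_mono:
  assumes "finite A" "finite B" "A' \<subseteq> A" "B' \<subseteq> B"
  shows "rep_count A' B' k \<le> rep_count A B k"
  unfolding rep_count_alt using assms by (intro card_mono) (auto intro: finite_subset)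

lemma rep_count_pos:
  assumes "finite A" "finite B" "\<alpha> \<in> A" "\<beta> \<in> B"
  shows "0 < rep_count A B (\<alpha> + \<beta>)"
  unfolding rep_count_alt using assms by (auto simp: card_gt_0_iff)

lemma rep_count_Times:
  "rep_count (I1 \<times> I2) (J1 \<times> J2) (k1, k2) = rep_count I1 J1 k1 * rep_count I2 J2 k2"
proof -
  let ?f = "\<lambda>((a1, a2), (b1, b2)). ((a1, b1), (a2, b2))"
  have "bij_betw ?f {p \<in> (I1 \<times> I2) \<times> (J1 \<times> J2). fst p + snd p = (k1, k2)}
      ({p \<in> I1 \<times> J1. fst p + snd p = k1} \<times> {p \<in> I2 \<times> J2. fst p + snd p = k2})"
    by (rule bij_betwI[where g = ?f]) auto
  then show ?thesis
    by (simp add: rep_count_alt bij_betw_same_card flip: card_cartesian_product)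
qed

text \<open>
  Cauchy-Schwarz on the fiber: it has \<open>rep_count A B k\<close> entries, on which \<open>G\<^sub>k\<close> has constant
  squared modulus \<open>1 / rep_count A B k\<close>, so \<open>G\<^sub>k\<close> contributes a factor of at most \<open>1\<close>. That factor is
  \<open>0\<close> for \<open>k\<close> outside \<open>A + B\<close>.
\<close>

lemma cmod_frob_inner_fiber_matrix_sq_le:
  assumes "finite A" "finite B"
  shows "(cmod (frob_inner A B (fiber_matrix A B k) M))\<^sup>2
           \<le> (\<Sum>p\<in>{p \<in> A \<times> B. fst p + snd p = k}. (cmod (M (fst p) (snd p)))\<^sup>2)"
proof -
  let ?P = "{p \<in> A \<times> B. fst p + snd p = k}" and ?w = "real (rep_count A B k)"
  let ?G = "\<lambda>p. cmod (fiber_matrix A B k (fst p) (snd p))"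
  let ?m = "\<lambda>p. cmod (M (fst p) (snd p))"
  have fin: "finite ?P" using assms by simp
  have "frob_inner A B (fiber_matrix A B k) M =
      (\<Sum>p\<in>A \<times> B. cnj (fiber_matrix A B k (fst p) (snd p)) * M (fst p) (snd p))"
    unfolding frob_inner_def by (subst sum.swap) (simp add: sum.cartesian_product case_prod_unfold)
  also have "\<dots> = (\<Sum>p\<in>?P. cnj (fiber_matrix A B k (fst p) (snd p)) * M (fst p) (snd p))"
    using assms by (intro sum.mono_neutral_right) (auto simp: fiber_matrix_def)
  finally have "cmod (frob_inner A B (fiber_matrix A B k) M) \<le> (\<Sum>p\<in>?P. ?G p * ?m p)"
    by (metis (mono_tags, lifting) norm_sum norm_mult complex_mod_cnj sum.cong)
  then have "(cmod (frob_inner A B (fiber_matrix A B k) M))\<^sup>2 \<le> (\<Sum>p\<in>?P. ?G p * ?m p)\<^sup>2"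
    by (rule power_mono) simp
  also have "\<dots> \<le> (\<Sum>p\<in>?P. (?G p)\<^sup>2) * (\<Sum>p\<in>?P. (?m p)\<^sup>2)"
    by (rule Cauchy_Schwarz_ineq_sum)
  also have "\<dots> \<le> 1 * (\<Sum>p\<in>?P. (?m p)\<^sup>2)"
  proof (rule mult_right_mono)
    have "(?G p)\<^sup>2 = 1 / ?w" if "p \<in> ?P" for p
    proof -
      have "0 < ?w" using that rep_count_pos[OF assms, of "fst p" "snd p"] by auto
      then show ?thesis using that
        by (auto simp: fiber_matrix_def powr_minus_divide powr_half_sqrt power_divide norm_divide)
    qed
    then have "(\<Sum>p\<in>?P. (?G p)\<^sup>2) = (\<Sum>p\<in>?P. 1 / ?w)" by (intro sum.cong) auto
    also have "\<dots> \<le> 1" by (simp add: rep_count_alt)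
    finally show "(\<Sum>p\<in>?P. (?G p)\<^sup>2) \<le> 1" .
  qed (simp add: sum_nonneg)
  finally show ?thesis by simp
qed

text \<open>
  Every pair of \<open>A \<times> B\<close> lies in exactly one fiber, so summing the previous bound over \<open>k\<close> counts each
  entry once.
\<close>

lemma fiber_norm_sq_le:
  assumes "finite A" "finite B"
  shows "fiber_norm_sq A B M
           \<le> (\<Sum>\<alpha>\<in>A. \<Sum>\<beta>\<in>B. (cmod (M \<alpha> \<beta>))\<^sup>2 / real (rep_count A B (\<alpha> + \<beta>)))"
proof -
  let ?h = "\<lambda>p. (cmod (M (fst p) (snd p)))\<^sup>2 / real (rep_count A B (fst p + snd p))"
  have "fiber_norm_sq A B M
      \<le> (\<Sum>k\<in>A + B. (\<Sum>p\<in>{p \<in> A \<times> B. fst p + snd p = k}. (cmod (M (fst p) (snd p)))\<^sup>2)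
            / real (rep_count A B k))"
    unfolding fiber_norm_sq_def
    by (intro sum_mono divide_right_mono cmod_frob_inner_fiber_matrix_sq_le assms) auto
  also have "\<dots> = (\<Sum>k\<in>A + B. \<Sum>p\<in>{p \<in> A \<times> B. fst p + snd p = k}. ?h p)"
    by (simp add: sum_divide_distrib)
  also have "\<dots> = (\<Sum>p\<in>A \<times> B. ?h p)"
    using assms by (intro sum.group) (auto simp: finite_set_plus intro: set_plus_intro)
  also have "\<dots> = (\<Sum>\<alpha>\<in>A. \<Sum>\<beta>\<in>B. (cmod (M \<alpha> \<beta>))\<^sup>2 / real (rep_count A B (\<alpha> + \<beta>)))"
    by (simp add: sum.cartesian_product case_prod_unfold)
  finally show ?thesis .
qed

section \<open>Intervals\<close>

text \<open>
  A bound for \<open>1 / rep_count I J (x + y)\<close> that is uniform in \<open>y \<in> J\<close>. The first two terms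
  account for \<open>x + y\<close> near the two ends of \<open>I + J\<close>, the last two for the plateau in the middle, where
  the count is the smaller of the two cardinalities.
\<close>

definition end_weight :: "int set \<Rightarrow> int set \<Rightarrow> int \<Rightarrow> real" where
  "end_weight I J x = 1 / real_of_int (x - Min I + 1) + 1 / real_of_int (Max I - x + 1)
     + 1 / real (card I) + 1 / real (card J)"

text \<open>
  The representations of \<open>x + y\<close> are parametrised by an interval of first summands, cut out by two
  lower and two upper bounds. Its length is therefore one of four numbers, two of which depend on \<open>y\<close>;
  each of these is smallest when \<open>y\<close> is an end of \<open>J\<close>, where it equals the distance from \<open>x\<close> to a
  point just outside \<open>I\<close>.
\<close>

lemma inverse_rep_count_le_end_weight:
  assumes "int_interval I" "int_interval J" "x \<in> I" "y \<in> J"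
  shows "1 / real (rep_count I J (x + y)) \<le> end_weight I J x"
proof -
  obtain a b where I: "I = {a..b}" "a \<le> b" using assms(1) by (auto simp: int_interval_def)
  obtain c d where J: "J = {c..d}" "c \<le> d" using assms(2) by (auto simp: int_interval_def)
  have ab: "Min I = a" "Max I = b" using I by (auto intro: Min_eqI Max_eqI)
  let ?k = "x + y" and ?w = "real (rep_count I J (x + y))"
  let ?T = "{max a (?k - d)..min b (?k - c)}"
  have "card ?T = card ((\<lambda>z. (z, ?k - z)) ` ?T)"
    by (rule card_image[symmetric]) (auto simp: inj_on_def)
  also have "\<dots> \<le> rep_count I J ?k"
    unfolding rep_count_alt using I J by (intro card_mono) auto
  finally have "real_of_int (min b (?k - c) - max a (?k - d) + 1) \<le> ?w" by simp
  \<comment> \<open>The four values of the two extrema give the four summands of the weight.\<close>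
  then have "real_of_int (x - a + 1) \<le> ?w \<or> real_of_int (b - x + 1) \<le> ?w
      \<or> real (card I) \<le> ?w \<or> real (card J) \<le> ?w"
    using assms(3,4) I J by (auto simp: min_def max_def split: if_splits)
  moreover have pos: "0 < real_of_int (x - a + 1)" "0 < real_of_int (b - x + 1)"
      "0 < real (card I)" "0 < real (card J)"
    using assms(3) I J by auto
  moreover have "1 / ?w \<le> 1 / t" if "0 < t" "t \<le> ?w" for t
    using that by (simp add: frac_le)
  moreover have "0 < 1 / real_of_int (x - a + 1)" "0 < 1 / real_of_int (b - x + 1)"
      "0 < 1 / real (card I)" "0 < 1 / real (card J)"
    using pos by (simp_all only: zero_less_divide_1_iff)
  ultimately show ?thesis unfolding end_weight_def ab by smt
qed

text \<open>
  As \<open>x\<close> runs through \<open>I\<close>, each of the two end distances takes the values \<open>1, \<dots>, |I|\<close> once, so both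
  give the harmonic number of \<open>|I|\<close>, which is at most \<open>1 + ln |I|\<close>.
\<close>

lemma sum_end_weight_le:
  assumes "int_interval I" "int_interval J"
  shows "(\<Sum>x\<in>I. end_weight I J x)
           \<le> 2 * (1 + ln (real (card I))) + 1 + real (card I) / real (card J)"
proof -
  obtain a b where I: "I = {a..b}" "a \<le> b" using assms(1) by (auto simp: int_interval_def)
  have ab: "Min I = a" "Max I = b" using I by (auto intro: Min_eqI Max_eqI)
  have n: "card I > 0" using I by simp
  have "(\<Sum>x\<in>I. 1 / real_of_int (x - a + 1)) = harm (card I)"
    unfolding harm_def using I
    by (intro sum.reindex_bij_witness[of _ "\<lambda>i. int i + a - 1" "\<lambda>x. nat (x - a + 1)"])
      (auto simp: divide_inverse)
  moreover have "(\<Sum>x\<in>I. 1 / real_of_int (b - x + 1)) = harm (card I)"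
    unfolding harm_def using I
    by (intro sum.reindex_bij_witness[of _ "\<lambda>i. b + 1 - int i" "\<lambda>x. nat (b - x + 1)"])
      (auto simp: divide_inverse)
  ultimately have "(\<Sum>x\<in>I. end_weight I J x)
      = 2 * harm (card I) + 1 + real (card I) / real (card J)"
    unfolding end_weight_def ab sum.distrib using n by simp
  then show ?thesis using euler_mascheroni_sequence_decreasing[of 1 "card I"] n by (simp add: harm_expand)
qed

lemma end_weight_nonneg:
  assumes "int_interval I" "x \<in> I"
  shows "0 \<le> end_weight I J x"
proof -
  have "finite I" using assms(1) by (auto simp: int_interval_def)
  then have "Min I \<le> x" "x \<le> Max I" using assms(2) by auto
  then show ?thesis by (simp add: end_weight_def)
qed

section \<open>Rectangles\<close>

lemma card_le_card_set_plus:
  fixes A B :: "'a::cancel_ab_semigroup_add set"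
  assumes "finite A" "finite B" "B \<noteq> {}"
  shows "card A \<le> card (A + B)"
proof -
  obtain b where "b \<in> B" using assms(3) by blast
  then have "(\<lambda>a. a + b) ` A \<subseteq> A + B" by (auto intro: set_plus_intro)
  moreover have "card ((\<lambda>a. a + b) ` A) = card A" by (simp add: card_image inj_on_def)
  ultimately show ?thesis using assms by (metis card_mono finite_set_plus)
qed

lemma rectangle_ratio_ge:
  assumes "i \<in> {1, 2}" "int_interval (I i)" "int_interval (J i)"
  shows "1 \<le> rectangle_ratio I J" "real (card (I i)) / real (card (J i)) \<le> rectangle_ratio I J"
proof -
  have fin: "finite (I i)" "finite (J i)" and ne: "I i \<noteq> {}" "J i \<noteq> {}"
    using assms(2,3) by (auto simp: int_interval_def)
  have le: "card (I i) \<le> card (I i + J i)" by (rule card_le_card_set_plus[OF fin ne(2)])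
  have "max (real (card (I i + J i)) / real (card (I i)))
            (real (card (I i + J i)) / real (card (J i))) \<le> rectangle_ratio I J"
    unfolding rectangle_ratio_def using assms(1) by (intro Max_ge) auto
  then have *: "real (card (I i + J i)) / real (card (I i)) \<le> rectangle_ratio I J"
      "real (card (I i + J i)) / real (card (J i)) \<le> rectangle_ratio I J" by auto
  have "1 \<le> real (card (I i + J i)) / real (card (I i))"
    using le fin ne by (simp add: le_divide_eq card_gt_0_iff)
  with *(1) show "1 \<le> rectangle_ratio I J" by linarith
  have "real (card (I i)) / real (card (J i)) \<le> real (card (I i + J i)) / real (card (J i))"
    using le by (intro divide_right_mono) auto
  with *(2) show "real (card (I i)) / real (card (J i)) \<le> rectangle_ratio I J" by linarith
qed

text \<open>
  Both \<open>ln (e N)\<close> and the ratio are at least \<open>1\<close>, so the sum of a multiple of one and the other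
  is absorbed into a multiple of their product.
\<close>

lemma sum_end_weight_le_rectangle_ratio:
  assumes "i \<in> {1, 2}" "int_interval (I i)" "int_interval (J i)" "card (I i) \<le> N"
  shows "(\<Sum>x\<in>I i. end_weight (I i) (J i) x)
           \<le> 4 * ln (exp 1 * real N) * rectangle_ratio I J"
proof -
  let ?L = "ln (exp 1 * real N)" and ?c = "rectangle_ratio I J"
  have pos: "0 < card (I i)" using assms(2) by (auto simp: int_interval_def)
  then have L: "?L = 1 + ln (real N)" using assms(4) by (simp add: ln_mult)
  have ln: "0 \<le> ln (real (card (I i)))" "ln (real (card (I i))) \<le> ln (real N)"
    using pos assms(4) by auto
  have c: "1 \<le> ?c" "real (card (I i)) / real (card (J i)) \<le> ?c"
    by (rule rectangle_ratio_ge[of i I J, OF assms(1-3)])+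
  have "(\<Sum>x\<in>I i. end_weight (I i) (J i) x) \<le> 3 * ?L + ?c"
    using sum_end_weight_le[OF assms(2,3)] c(2) ln unfolding L by argo
  also have "\<dots> \<le> 3 * ?L * ?c + ?L * ?c"
  proof (rule add_mono)
    show "3 * ?L \<le> 3 * ?L * ?c" using mult_left_mono[OF c(1), of "3 * ?L"] ln L by simp
    show "?c \<le> ?L * ?c" using mult_right_mono[of 1 ?L ?c] c(1) ln L by simp
  qed
  finally show ?thesis by (simp add: mult.commute mult.left_commute)
qed

text \<open>
  The weight \<open>?g 1 (fst \<alpha>) * ?g 2 (snd \<alpha>)\<close> that replaces \<open>1 / w(\<alpha> + \<beta>)\<close> does not depend on
  \<open>\<beta>\<close>, so the sum over \<open>\<beta>\<close> can be carried out first and costs only the norm of a row. The sum over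
  \<open>\<alpha>\<close> then factors into the two coordinates.
\<close>

lemma rectangle_block_le:
  fixes A B :: "(int \<times> int) set" and I J :: "nat \<Rightarrow> int set"
  assumes fin: "finite A" "finite B"
    and sub: "I 1 \<times> I 2 \<subseteq> A" "J 1 \<times> J 2 \<subseteq> B"
    and int: "\<And>i. i \<in> {1, 2} \<Longrightarrow> int_interval (I i)" "\<And>i. i \<in> {1, 2} \<Longrightarrow> int_interval (J i)"
  shows "(\<Sum>\<alpha>\<in>I 1 \<times> I 2. \<Sum>\<beta>\<in>J 1 \<times> J 2. (cmod (M \<alpha> \<beta>))\<^sup>2 / real (rep_count A B (\<alpha> + \<beta>)))
           \<le> 16 * (ln (exp 1 * real (card (A + B))))\<^sup>2 * (rectangle_ratio I J)\<^sup>2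
               * row_col_norm_sq A B M"
proof -
  let ?D = "row_col_norm_sq A B M" and ?N = "card (A + B)"
  let ?g = "\<lambda>i. end_weight (I i) (J i)"
  let ?K = "4 * ln (exp 1 * real ?N) * rectangle_ratio I J"
  have finI: "finite (I i)" "finite (J i)" and ne: "I i \<noteq> {}" "J i \<noteq> {}"
    if "i \<in> {1, 2}" for i
    using int[OF that] by (auto simp: int_interval_def)
  have finR: "finite (I 1 \<times> I 2)" "finite (J 1 \<times> J 2)" using finI by auto
  have g0: "0 \<le> ?g i x" if "i \<in> {1, 2}" "x \<in> I i" for i x
    using end_weight_nonneg int(1) that by blast
  obtain \<alpha>0 \<beta>0 where "\<alpha>0 \<in> A" "\<beta>0 \<in> B" using sub ne[of 1] ne[of 2] by force
  then have D0: "0 \<le> ?D"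
    using entry_le_row_col_norm_sq[OF fin, of \<alpha>0 \<beta>0 M] by (meson order_trans zero_le_power2)
  have row: "(\<Sum>\<beta>\<in>J 1 \<times> J 2. (cmod (M \<alpha> \<beta>))\<^sup>2) \<le> ?D" if "\<alpha> \<in> I 1 \<times> I 2" for \<alpha>
  proof -
    have "(\<Sum>\<beta>\<in>J 1 \<times> J 2. (cmod (M \<alpha> \<beta>))\<^sup>2) \<le> (\<Sum>\<beta>\<in>B. (cmod (M \<alpha> \<beta>))\<^sup>2)"
      using fin sub by (intro sum_mono2) auto
    also have "\<dots> \<le> ?D"
      unfolding row_col_norm_sq_def using fin sub that by (intro Max_ge) auto
    finally show ?thesis .
  qed
  have weight: "1 / real (rep_count A B (\<alpha> + \<beta>)) \<le> ?g 1 (fst \<alpha>) * ?g 2 (snd \<alpha>)"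
    if "\<alpha> \<in> I 1 \<times> I 2" "\<beta> \<in> J 1 \<times> J 2" for \<alpha> \<beta>
  proof -
    have "1 / real (rep_count A B (\<alpha> + \<beta>)) \<le> 1 / real (rep_count (I 1 \<times> I 2) (J 1 \<times> J 2) (\<alpha> + \<beta>))"
      using rep_count_mono[OF fin sub] rep_count_pos[OF finR that] by (simp add: frac_le)
    also have "\<dots> = (1 / real (rep_count (I 1) (J 1) (fst \<alpha> + fst \<beta>)))
        * (1 / real (rep_count (I 2) (J 2) (snd \<alpha> + snd \<beta>)))"
      by (simp add: plus_prod_def rep_count_Times)
    also have "\<dots> \<le> ?g 1 (fst \<alpha>) * ?g 2 (snd \<alpha>)"
      using that int g0 by (intro mult_mono inverse_rep_count_le_end_weight) auto
    finally show ?thesis .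
  qed
  have "(\<Sum>\<alpha>\<in>I 1 \<times> I 2. \<Sum>\<beta>\<in>J 1 \<times> J 2. (cmod (M \<alpha> \<beta>))\<^sup>2 / real (rep_count A B (\<alpha> + \<beta>)))
      \<le> (\<Sum>\<alpha>\<in>I 1 \<times> I 2. \<Sum>\<beta>\<in>J 1 \<times> J 2. (cmod (M \<alpha> \<beta>))\<^sup>2 * (?g 1 (fst \<alpha>) * ?g 2 (snd \<alpha>)))"
  proof (intro sum_mono)
    fix \<alpha> \<beta> assume "\<alpha> \<in> I 1 \<times> I 2" "\<beta> \<in> J 1 \<times> J 2"
    from mult_left_mono[OF weight[OF this], of "(cmod (M \<alpha> \<beta>))\<^sup>2"]
    show "(cmod (M \<alpha> \<beta>))\<^sup>2 / real (rep_count A B (\<alpha> + \<beta>))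
        \<le> (cmod (M \<alpha> \<beta>))\<^sup>2 * (?g 1 (fst \<alpha>) * ?g 2 (snd \<alpha>))" by simp
  qed
  also have "\<dots> = (\<Sum>\<alpha>\<in>I 1 \<times> I 2. (\<Sum>\<beta>\<in>J 1 \<times> J 2. (cmod (M \<alpha> \<beta>))\<^sup>2) * (?g 1 (fst \<alpha>) * ?g 2 (snd \<alpha>)))"
    by (simp only: sum_distrib_right)
  also have "\<dots> \<le> (\<Sum>\<alpha>\<in>I 1 \<times> I 2. ?D * (?g 1 (fst \<alpha>) * ?g 2 (snd \<alpha>)))"
    using row g0 by (intro sum_mono mult_right_mono mult_nonneg_nonneg) auto
  also have "\<dots> = ?D * ((\<Sum>x\<in>I 1. ?g 1 x) * (\<Sum>x\<in>I 2. ?g 2 x))"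
    by (subst sum_product)
      (simp only: sum.cartesian_product case_prod_unfold flip: sum_distrib_left[of ?D])
  also have "\<dots> \<le> ?D * (?K * ?K)"
  proof -
    have "card (I 1) * card (I 2) \<le> card A"
      using card_mono[OF fin(1) sub(1)] by (simp add: card_cartesian_product)
    also have "\<dots> \<le> ?N"
      using fin \<open>\<beta>0 \<in> B\<close> by (intro card_le_card_set_plus) auto
    finally have prod: "card (I 1) * card (I 2) \<le> ?N" .
    have pos: "0 < card (I 1)" "0 < card (I 2)" using finI ne by (simp_all add: card_gt_0_iff)
    have card: "card (I i) \<le> ?N" if "i \<in> {1, 2}" for i
    proof -
      have "card (I i) \<le> card (I 1) * card (I 2)" using that pos by auto
      with prod show ?thesis by simp
    qed
    have K: "(\<Sum>x\<in>I i. ?g i x) \<le> ?K" if "i \<in> {1, 2}" for i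
      using sum_end_weight_le_rectangle_ratio[OF that, of I J ?N] int card that by blast
    have S0: "0 \<le> (\<Sum>x\<in>I i. ?g i x)" if "i \<in> {1, 2}" for i
      using g0 that by (intro sum_nonneg) auto
    have "0 \<le> ?K" using order_trans[OF S0[of 1] K[of 1]] by simp
    then show ?thesis
      using K[of 1] K[of 2] S0[of 1] S0[of 2] D0 by (intro mult_left_mono mult_mono) auto
  qed
  also have "\<dots> = 16 * (ln (exp 1 * real ?N))\<^sup>2 * (rectangle_ratio I J)\<^sup>2 * ?D"
    by (simp add: power2_eq_square)
  finally show ?thesis .
qed

section \<open>Unions of rectangles\<close>

lemma sum_UN_le:
  fixes f :: "'a \<Rightarrow> real"
  assumes "finite U" "\<And>u. u \<in> U \<Longrightarrow> finite (X u)" "\<And>x. x \<in> (\<Union>u\<in>U. X u) \<Longrightarrow> 0 \<le> f x"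
  shows "sum f (\<Union>u\<in>U. X u) \<le> (\<Sum>u\<in>U. sum f (X u))"
  using assms
proof (induction U)
  case (insert u U)
  have "sum f (X u \<union> (\<Union>u\<in>U. X u)) \<le> sum f (X u) + sum f (\<Union>u\<in>U. X u)"
    using insert.prems insert.hyps by (subst sum_Un) (auto intro!: sum_nonneg)
  also have "\<dots> \<le> sum f (X u) + (\<Sum>u\<in>U. sum f (X u))"
    using insert.prems by (intro add_left_mono insert.IH) auto
  finally show ?case using insert.hyps by simp
qed simp

theorem proposition4p9:
  shows "\<exists>C1::real. C1 > 0 \<and>
    (\<forall>(A::(int \<times> int) set) (B::(int \<times> int) set) (RA::nat) (RB::nat)
       (I::nat \<Rightarrow> nat \<Rightarrow> int set) (J::nat \<Rightarrow> nat \<Rightarrow> int set).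
       finite A \<longrightarrow> A \<noteq> {} \<longrightarrow> finite B \<longrightarrow> B \<noteq> {} \<longrightarrow>
       (\<forall>u\<in>{1..RA}. \<forall>i\<in>{1, 2}. int_interval (I u i)) \<longrightarrow>
       (\<forall>v\<in>{1..RB}. \<forall>i\<in>{1, 2}. int_interval (J v i)) \<longrightarrow>
       A = (\<Union>u\<in>{1..RA}. I u 1 \<times> I u 2) \<longrightarrow>
       disjoint_family_on (\<lambda>u. I u 1 \<times> I u 2) {1..RA} \<longrightarrow>
       B = (\<Union>v\<in>{1..RB}. J v 1 \<times> J v 2) \<longrightarrow>
       disjoint_family_on (\<lambda>v. J v 1 \<times> J v 2) {1..RB} \<longrightarrow>
       fiber_parameter A B \<le>
         C1 * (ln (exp 1 * real (card (A + B))))\<^sup>2 *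
         (\<Sum>u=1..RA. \<Sum>v=1..RB. (rectangle_ratio (I u) (J v))\<^sup>2))"
proof (intro exI[of _ 16] conjI allI impI)
  fix A B :: "(int \<times> int) set" and RA RB :: nat and I J :: "nat \<Rightarrow> nat \<Rightarrow> int set"
  assume fin: "finite A" "finite B" and ne: "A \<noteq> {}" "B \<noteq> {}"
    and int: "\<forall>u\<in>{1..RA}. \<forall>i\<in>{1, 2}. int_interval (I u i)"
      "\<forall>v\<in>{1..RB}. \<forall>i\<in>{1, 2}. int_interval (J v i)"
    and A: "A = (\<Union>u\<in>{1..RA}. I u 1 \<times> I u 2)" and B: "B = (\<Union>v\<in>{1..RB}. J v 1 \<times> J v 2)"
  let ?L = "ln (exp 1 * real (card (A + B)))"
  let ?S = "\<Sum>u=1..RA. \<Sum>v=1..RB. (rectangle_ratio (I u) (J v))\<^sup>2"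
  show "fiber_parameter A B \<le> 16 * ?L\<^sup>2 * ?S"
    unfolding fiber_parameter_def
  proof (rule cSUP_least[OF fiber_parameter_nonempty[OF ne]])
    fix M assume M: "M \<in> {M \<in> matrices A B. M \<noteq> (\<lambda>_ _. 0)}"
    let ?D = "row_col_norm_sq A B M"
    let ?t = "\<lambda>\<alpha> \<beta>. (cmod (M \<alpha> \<beta>))\<^sup>2 / real (rep_count A B (\<alpha> + \<beta>))"
    have D: "0 < ?D" using row_col_norm_sq_pos[OF fin] M by blast
    have subA: "I u 1 \<times> I u 2 \<subseteq> A" if "u \<in> {1..RA}" for u using A that by auto
    have subB: "J v 1 \<times> J v 2 \<subseteq> B" if "v \<in> {1..RB}" for v using B that by auto
    have finA: "finite (I u 1 \<times> I u 2)" if "u \<in> {1..RA}" for u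
      using finite_subset[OF subA[OF that] fin(1)] .
    have finB: "finite (J v 1 \<times> J v 2)" if "v \<in> {1..RB}" for v
      using finite_subset[OF subB[OF that] fin(2)] .
    have "fiber_norm_sq A B M \<le> (\<Sum>\<alpha>\<in>A. \<Sum>\<beta>\<in>B. ?t \<alpha> \<beta>)"
      by (rule fiber_norm_sq_le[OF fin])
    also have "\<dots> \<le> (\<Sum>u=1..RA. \<Sum>\<alpha>\<in>I u 1 \<times> I u 2. \<Sum>\<beta>\<in>B. ?t \<alpha> \<beta>)"
      by (subst (1) A, rule sum_UN_le) (use finA in \<open>auto intro!: sum_nonneg\<close>)
    also have "\<dots> \<le> (\<Sum>u=1..RA. \<Sum>\<alpha>\<in>I u 1 \<times> I u 2. \<Sum>v=1..RB. \<Sum>\<beta>\<in>J v 1 \<times> J v 2. ?t \<alpha> \<beta>)"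
      by (intro sum_mono, subst (1) B, rule sum_UN_le) (use finB in auto)
    also have "\<dots> = (\<Sum>u=1..RA. \<Sum>v=1..RB. \<Sum>\<alpha>\<in>I u 1 \<times> I u 2. \<Sum>\<beta>\<in>J v 1 \<times> J v 2. ?t \<alpha> \<beta>)"
      by (intro sum.cong refl sum.swap)
    also have "\<dots> \<le> (\<Sum>u=1..RA. \<Sum>v=1..RB. 16 * ?L\<^sup>2 * (rectangle_ratio (I u) (J v))\<^sup>2 * ?D)"
      using int subA subB by (intro sum_mono rectangle_block_le fin) blast+
    also have "\<dots> = 16 * ?L\<^sup>2 * ?S * ?D"
      by (simp only: sum_distrib_left sum_distrib_right)
    finally show "fiber_norm_sq A B M / ?D \<le> 16 * ?L\<^sup>2 * ?S"
      using D by (simp add: divide_le_eq)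
  qed
qed simp

end
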